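(* Let $\alpha\le\omega_1$ and let $(\tau_\xi)_{\xi<\alpha\oplus1}$ be a filtration from $\sigma$ (topologies on a set $X$) such that $\tau_\xi$ is completely metrizable for each $\xi<\alpha$. Let $E$ be an equivalence relation on $X$ all of whose equivalence classes are solid. If every equivalence class of $E$ belongs to $\bigcup_{\xi<\alpha}\mathbf\Pi^0_{1+\xi}$ with respect to $\sigma$, then $E=\bigcap_{\xi<\alpha}E_\xi$.
   Context: For an ordinal $\alpha$, $\alpha\oplus1=\alpha+1$ if $\alpha$ is a successor, and $\alpha\oplus1=\alpha$ if $\alpha=0$ or $\alpha$ is a limit. A sequence $(\tau_\xi)_{\xi<\rho}$ of topologies on $X$ is a filtration from $\sigma$ if $\sigma=\tau_0\subseteq\tau_1\subseteq\cdots$ and for each $\beta<\rho$, whenever $F$ is $\tau_\xi$-closed for some $\xi<\beta$, ${\rm int}_{\tau_\beta}(F)={\rm int}_{\tau^*}(F)$, where $\tau^*$ is the smallest topology containing all $\tau_\xi$, $\xi<\rho$. For $\xi<\rho$, $E_\xi$ is the equivalence relation $xE_\xi y\iff{\rm cl}_{\tau_\xi}([x]_E)={\rm cl}_{\tau_\xi}([y]_E)$. For $\beta<\rho$, the $\beta$-tame sets form the smallest family of subsets of $X$ containing all $\tau_\xi$-closed sets for every $\xi<\beta$ and closed under: if $\xi<\beta$, $\mathcal U$ is a $\tau_\xi$-discrete family of $\tau_\xi$-open sets and each $F^U$ ($U\in\mathcal U$) is $\beta$-tame, then $\bigcup_{U\in\mathcal U}(F^U\cap U)$ is $\beta$-tame.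 A set $A$ is $\beta$-solid if for each countable family $\mathcal F$ of $\beta$-tame sets such that $\bigcup\mathcal F$ contains a non-empty relatively $\tau_\beta$-open subset of $A$, some $F\in\mathcal F$ has ${\rm int}_{\tau_\beta}(F)\neq\emptyset$; $A$ is solid if it is $\beta$-solid for every $\beta<\rho$ (here $\rho=\alpha\oplus1$). With respect to $\sigma$: $\mathbf\Pi^0_1$ is the family of $\sigma$-closed sets and for $\xi\ge1$, $\mathbf\Pi^0_{1+\xi}$ consists of complements of countable unions of sets in $\bigcup_{\gamma<\xi}\mathbf\Pi^0_{1+\gamma}$. *)

theory Defs
  imports "HOL-Analysis.Analysis"
begin

text \<open>
  Ordinals are elements of an arbitrary type of class \<open>wellorder\<close>: the element \<open>\<alpha>\<close> stands for the
  order type of \<open>{..<\<alpha>}\<close>. Every ordinal is represented in a suitable such type. An index set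
  \<open>{\<xi>. \<xi> < \<rho>}\<close> is given as the set \<open>R\<close> of its elements, so that \<open>\<rho>\<close> itself (for instance
  \<open>\<alpha> + 1\<close>) need not be an element of the type.
\<close>

definition ord_zero :: "'i::wellorder" where
  "ord_zero = (LEAST \<xi>. True)"

definition is_successor :: "'i::wellorder \<Rightarrow> bool" where
  "is_successor \<alpha> \<longleftrightarrow> (\<exists>\<beta><\<alpha>. \<forall>\<gamma><\<alpha>. \<gamma> \<le> \<beta>)"

text \<open>The ordinals below \<open>\<alpha> \<oplus> 1\<close>; here \<open>{..\<alpha>}\<close> are those below \<open>\<alpha> + 1\<close>.\<close>

definition below_oplus1 :: "'i::wellorder \<Rightarrow> 'i set" where
  "below_oplus1 \<alpha> = (if is_successor \<alpha> then {..\<alpha>} else {..<\<alpha>})"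

text \<open>
  The well-order of \<open>{..<\<alpha>}\<close> is compared with the initial ordinal \<open>cardSuc natLeq\<close>,
  which has order type \<open>\<omega>\<^sub>1\<close>.
\<close>

definition le_omega1 :: "'i::wellorder \<Rightarrow> bool" where
  "le_omega1 \<alpha> \<longleftrightarrow> ({(\<xi>, \<eta>). \<xi> \<le> \<eta> \<and> \<eta> < \<alpha>}, cardSuc natLeq) \<in> ordLeq"

definition sup_topology :: "'i set \<Rightarrow> ('i \<Rightarrow> 'a topology) \<Rightarrow> 'a topology" where
  "sup_topology R \<tau> = topology_generated_by {U. \<exists>\<xi>\<in>R. openin (\<tau> \<xi>) U}"

definition filtration_from ::
    "'a set \<Rightarrow> 'a topology \<Rightarrow> 'i::wellorder set \<Rightarrow> ('i \<Rightarrow> 'a topology) \<Rightarrow> bool" where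
  "filtration_from X \<sigma> R \<tau> \<longleftrightarrow>
     topspace \<sigma> = X \<and>
     (\<forall>\<xi>\<in>R. topspace (\<tau> \<xi>) = X) \<and>
     (ord_zero \<in> R \<longrightarrow> \<tau> ord_zero = \<sigma>) \<and>
     (\<forall>\<xi>\<in>R. \<forall>\<eta>\<in>R. \<xi> \<le> \<eta> \<longrightarrow> (\<forall>U. openin (\<tau> \<xi>) U \<longrightarrow> openin (\<tau> \<eta>) U)) \<and>
     (\<forall>\<beta>\<in>R. \<forall>F. (\<exists>\<xi><\<beta>. closedin (\<tau> \<xi>) F) \<longrightarrow>
        (\<tau> \<beta>) interior_of F = (sup_topology R \<tau>) interior_of F)"

definition closure_equiv ::
    "'a set \<Rightarrow> ('i \<Rightarrow> 'a topology) \<Rightarrow> ('a \<times> 'a) set \<Rightarrow> 'i \<Rightarrow> ('a \<times> 'a) set" where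
  "closure_equiv X \<tau> E \<xi> =
     {(x, y). x \<in> X \<and> y \<in> X \<and> (\<tau> \<xi>) closure_of (E `` {x}) = (\<tau> \<xi>) closure_of (E `` {y})}"

definition discrete_family_in :: "'a topology \<Rightarrow> 'a set set \<Rightarrow> bool" where
  "discrete_family_in T \<U> \<longleftrightarrow>
     (\<forall>x\<in>topspace T. \<exists>V. openin T V \<and> x \<in> V \<and> (\<exists>\<^sub>\<le>\<^sub>1U. U \<in> \<U> \<and> U \<inter> V \<noteq> {}))"

inductive_set tame :: "('i::wellorder \<Rightarrow> 'a topology) \<Rightarrow> 'i \<Rightarrow> 'a set set"
  for \<tau> :: "'i::wellorder \<Rightarrow> 'a topology" and \<beta> :: 'i where
  closed: "\<xi> < \<beta> \<Longrightarrow> closedin (\<tau> \<xi>) F \<Longrightarrow> F \<in> tame \<tau> \<beta>"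
| discrete_union:
    "\<xi> < \<beta> \<Longrightarrow> (\<And>U. U \<in> \<U> \<Longrightarrow> openin (\<tau> \<xi>) U) \<Longrightarrow> discrete_family_in (\<tau> \<xi>) \<U> \<Longrightarrow>
     (\<And>U. U \<in> \<U> \<Longrightarrow> F U \<in> tame \<tau> \<beta>) \<Longrightarrow> (\<Union>U\<in>\<U>. F U \<inter> U) \<in> tame \<tau> \<beta>"

definition solid_at :: "('i::wellorder \<Rightarrow> 'a topology) \<Rightarrow> 'i \<Rightarrow> 'a set \<Rightarrow> bool" where
  "solid_at \<tau> \<beta> A \<longleftrightarrow>
     (\<forall>\<F>. countable \<F> \<and> \<F> \<subseteq> tame \<tau> \<beta> \<and>
        (\<exists>V. openin (subtopology (\<tau> \<beta>) A) V \<and> V \<noteq> {} \<and> V \<subseteq> \<Union>\<F>) \<longrightarrow>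
        (\<exists>F\<in>\<F>. (\<tau> \<beta>) interior_of F \<noteq> {}))"

definition solid :: "'i::wellorder set \<Rightarrow> ('i \<Rightarrow> 'a topology) \<Rightarrow> 'a set \<Rightarrow> bool" where
  "solid R \<tau> A \<longleftrightarrow> (\<forall>\<beta>\<in>R. solid_at \<tau> \<beta> A)"

text \<open>\<open>Pi0 \<sigma> \<xi>\<close> is the class \<open>\<Pi>\<^sup>0\<close> with index \<open>1 + \<xi>\<close> (not \<open>\<xi>\<close>) of the topology \<open>\<sigma>\<close>.\<close>

function Pi0 :: "'a topology \<Rightarrow> 'i::wellorder \<Rightarrow> 'a set set" where
  "Pi0 \<sigma> \<xi> =
     (if \<xi> = ord_zero then {C. closedin \<sigma> C}
      else {topspace \<sigma> - \<Union>\<A> | \<A>. countable \<A> \<and> \<A> \<subseteq> (\<Union>\<gamma>\<in>{..<\<xi>}. Pi0 \<sigma> \<gamma>)})"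
  by pat_completeness auto
termination
  by (relation "inv_image {(x, y). x < y} snd") (auto intro: wf_inv_image wf)

declare Pi0.simps [simp del]

end

theory Submission
  imports Defs
begin

text \<open>
  Fix \<open>\<beta>\<close> and call a set small if countably many \<open>\<beta>\<close>-tame sets with empty \<open>\<tau>\<^sub>\<beta>\<close>-interior cover it.
  For \<open>\<xi> < \<beta>\<close>, every set in \<open>\<Pi>\<^sup>0\<close> with index \<open>1 + \<xi>\<close> differs from some \<open>\<tau>\<^sub>\<xi>\<close>-closed set by a small
  set: if \<open>F\<close> is \<open>\<tau>\<^sub>\<gamma>\<close>-closed with \<open>\<gamma> < \<xi>\<close>, then its \<open>\<tau>\<^sub>\<xi>\<close>- and \<open>\<tau>\<^sub>\<beta>\<close>-interiors coincide, so \<open>F\<close>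
  minus its \<open>\<tau>\<^sub>\<xi>\<close>-interior is \<open>\<tau>\<^sub>\<xi>\<close>-closed with empty \<open>\<tau>\<^sub>\<beta>\<close>-interior, hence small.
  Now let \<open>C\<close> and \<open>D\<close> be disjoint classes with the same \<open>\<tau>\<^sub>\<xi>\<close>-closure and let \<open>F\<close> approximate \<open>C\<close> in this
  way. The set \<open>C - F\<close> is small and relatively open in the solid set \<open>C\<close>, hence empty, so
  \<open>D\<close> is contained in the \<open>\<tau>\<^sub>\<xi>\<close>-closure of \<open>C\<close> and thus in \<open>F - C\<close>, which is small,
  contradicting the solidity of \<open>D\<close>.
\<close>

definition tame_small :: "('i::wellorder \<Rightarrow> 'a topology) \<Rightarrow> 'i \<Rightarrow> 'a set \<Rightarrow> bool" where
  "tame_small \<tau> \<beta> S \<longleftrightarrow>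
     (\<exists>\<F>. countable \<F> \<and> \<F> \<subseteq> tame \<tau> \<beta> \<and> (\<forall>F\<in>\<F>. \<tau> \<beta> interior_of F = {}) \<and> S \<subseteq> \<Union>\<F>)"

lemma tame_small_subset: "tame_small \<tau> \<beta> T \<Longrightarrow> S \<subseteq> T \<Longrightarrow> tame_small \<tau> \<beta> S"
  unfolding tame_small_def by (meson order_trans)

lemma tame_small_empty: "tame_small \<tau> \<beta> {}"
  unfolding tame_small_def by (rule exI[of _ "{}"]) simp

lemma tame_small_tame:
  "F \<in> tame \<tau> \<beta> \<Longrightarrow> \<tau> \<beta> interior_of F = {} \<Longrightarrow> tame_small \<tau> \<beta> F"
  unfolding tame_small_def by (rule exI[of _ "{F}"]) simp

text \<open>Small sets form a sigma-ideal, like meager sets: the chosen countable families for the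
  \<open>S i\<close> are merged into one.\<close>

lemma tame_small_UN:
  assumes "countable I" and "\<And>i. i \<in> I \<Longrightarrow> tame_small \<tau> \<beta> (S i)"
  shows "tame_small \<tau> \<beta> (\<Union>i\<in>I. S i)"
proof -
  have "\<forall>i\<in>I. \<exists>\<F>. countable \<F> \<and> \<F> \<subseteq> tame \<tau> \<beta> \<and> (\<forall>F\<in>\<F>. \<tau> \<beta> interior_of F = {}) \<and> S i \<subseteq> \<Union>\<F>"
    using assms(2) unfolding tame_small_def by blast
  from bchoice[OF this] obtain \<F> where \<F>: "\<forall>i\<in>I. countable (\<F> i) \<and> \<F> i \<subseteq> tame \<tau> \<beta> \<and>
      (\<forall>F\<in>\<F> i. \<tau> \<beta> interior_of F = {}) \<and> S i \<subseteq> \<Union>(\<F> i)"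
    by (rule exE)
  have "countable (\<Union>i\<in>I. \<F> i)"
    using assms(1) \<F> by (intro countable_UN) auto
  moreover have "(\<Union>i\<in>I. \<F> i) \<subseteq> tame \<tau> \<beta>"
    using \<F> by blast
  moreover have "\<forall>F\<in>(\<Union>i\<in>I. \<F> i). \<tau> \<beta> interior_of F = {}"
    using \<F> by blast
  moreover have "(\<Union>i\<in>I. S i) \<subseteq> \<Union>(\<Union>i\<in>I. \<F> i)"
  proof
    fix x assume "x \<in> (\<Union>i\<in>I. S i)"
    then obtain i where i: "i \<in> I" "x \<in> S i"
      by (rule UN_E)
    moreover have "S i \<subseteq> \<Union>(\<F> i)"
      using \<F> i(1) by simp
    ultimately show "x \<in> \<Union>(\<Union>i\<in>I. \<F> i)"
      by blast
  qed
  ultimately show ?thesis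
    unfolding tame_small_def by (intro exI[of _ "\<Union>i\<in>I. \<F> i"] conjI)
qed

lemma tame_small_Un:
  assumes "tame_small \<tau> \<beta> S" "tame_small \<tau> \<beta> T"
  shows "tame_small \<tau> \<beta> (S \<union> T)"
  using tame_small_UN[of "{True, False}" \<tau> \<beta> "\<lambda>b. if b then S else T"] assms
  by (simp add: Un_commute)

text \<open>This is solidity in Baire category form: a family witnessing that a nonempty
  \<open>V\<close> is small would have a member with nonempty interior.\<close>

lemma solid_at_small_open_empty:
  assumes "solid_at \<tau> \<beta> A" "openin (subtopology (\<tau> \<beta>) A) V" "tame_small \<tau> \<beta> V"
  shows "V = {}"
  using assms unfolding solid_at_def tame_small_def by blast

lemma filtration_from_topspace:
  "filtration_from X \<sigma> R \<tau> \<Longrightarrow> \<xi> \<in> R \<Longrightarrow> topspace (\<tau> \<xi>) = X"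
  unfolding filtration_from_def by simp

lemma filtration_from_closedin_mono:
  assumes "filtration_from X \<sigma> R \<tau>" "\<xi> \<in> R" "\<eta> \<in> R" "\<xi> \<le> \<eta>" "closedin (\<tau> \<xi>) F"
  shows "closedin (\<tau> \<eta>) F"
  using assms unfolding filtration_from_def closedin_def by simp

lemma filtration_from_interior_of:
  assumes "filtration_from X \<sigma> R \<tau>" "\<gamma> < \<xi>" "\<xi> \<in> R" "closedin (\<tau> \<gamma>) F"
  shows "\<tau> \<xi> interior_of F = sup_topology R \<tau> interior_of F"
proof -
  have "\<forall>\<beta>\<in>R. \<forall>F. (\<exists>\<xi><\<beta>. closedin (\<tau> \<xi>) F) \<longrightarrow>
      \<tau> \<beta> interior_of F = sup_topology R \<tau> interior_of F"
    using assms(1) unfolding filtration_from_def by (elim conjE)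
  then show ?thesis
    using assms(2-4) by blast
qed

lemma Pi0_zero: "Pi0 \<sigma> ord_zero = {C. closedin \<sigma> C}"
  by (subst Pi0.simps) simp

lemma Pi0_nonzeroE:
  assumes "A \<in> Pi0 \<sigma> \<xi>" "\<xi> \<noteq> ord_zero"
  obtains \<A> where "countable \<A>" "\<A> \<subseteq> (\<Union>\<gamma>\<in>{..<\<xi>}. Pi0 \<sigma> \<gamma>)" "A = topspace \<sigma> - \<Union>\<A>"
proof -
  have "Pi0 \<sigma> \<xi> = {topspace \<sigma> - \<Union>\<A> | \<A>. countable \<A> \<and> \<A> \<subseteq> (\<Union>\<gamma>\<in>{..<\<xi>}. Pi0 \<sigma> \<gamma>)}"
    by (rule trans[OF Pi0.simps if_not_P[OF assms(2)]])
  with assms(1) have "\<exists>\<A>. A = topspace \<sigma> - \<Union>\<A> \<and> countable \<A> \<and> \<A> \<subseteq> (\<Union>\<gamma>\<in>{..<\<xi>}. Pi0 \<sigma> \<gamma>)"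
    by (simp only: mem_Collect_eq)
  then show thesis
    using that by (elim exE conjE)
qed

text \<open>An analogue of the Baire property, by induction on \<open>\<xi>\<close> with
  \<open>\<beta>\<close> fixed, so that all errors lie in one sigma-ideal.\<close>

lemma Pi0_closed_mod_small:
  assumes filt: "filtration_from X \<sigma> R \<tau>"
    and \<beta>: "\<beta> \<in> R" and down: "\<And>\<xi>. \<xi> < \<beta> \<Longrightarrow> \<xi> \<in> R"
    and "\<xi> < \<beta>" "A \<in> Pi0 \<sigma> \<xi>"
  shows "\<exists>F. closedin (\<tau> \<xi>) F \<and> tame_small \<tau> \<beta> (A - F) \<and> tame_small \<tau> \<beta> (F - A)"
  using assms(4,5)
proof (induction \<xi> arbitrary: A rule: less_induct)
  case (less \<xi>)
  have \<xi>R: "\<xi> \<in> R"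
    using down less.prems by blast
  show ?case
  proof (cases "\<xi> = ord_zero")
    case True
    then have "closedin (\<tau> \<xi>) A"
      using less.prems(2) filt \<xi>R by (simp add: Pi0_zero filtration_from_def)
    then show ?thesis
      using tame_small_empty by (intro exI[of _ A]) simp
  next
    case False
    with less.prems(2) obtain \<A> where \<A>: "countable \<A>" "\<A> \<subseteq> (\<Union>\<gamma>\<in>{..<\<xi>}. Pi0 \<sigma> \<gamma>)"
      and A: "A = topspace \<sigma> - \<Union>\<A>"
      by (rule Pi0_nonzeroE)
    have ts: "topspace \<sigma> = X" "topspace (\<tau> \<xi>) = X"
      using filt \<xi>R by (simp_all add: filtration_from_def)
    have "\<forall>B\<in>\<A>. \<exists>F. (\<exists>\<gamma><\<xi>. closedin (\<tau> \<gamma>) F) \<and> tame_small \<tau> \<beta> (B - F) \<and> tame_small \<tau> \<beta> (F - B)"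
    proof
      fix B assume "B \<in> \<A>"
      then obtain \<gamma> where "\<gamma> < \<xi>" "B \<in> Pi0 \<sigma> \<gamma>"
        using \<A> by blast
      then show "\<exists>F. (\<exists>\<gamma><\<xi>. closedin (\<tau> \<gamma>) F) \<and> tame_small \<tau> \<beta> (B - F) \<and> tame_small \<tau> \<beta> (F - B)"
        using less.IH[of \<gamma> B] less.prems(1) by (meson order_less_trans)
    qed
    from bchoice[OF this] obtain F where
      "\<forall>B\<in>\<A>. (\<exists>\<gamma><\<xi>. closedin (\<tau> \<gamma>) (F B)) \<and>
         tame_small \<tau> \<beta> (B - F B) \<and> tame_small \<tau> \<beta> (F B - B)"
      by (rule exE)
    then have F: "\<And>B. B \<in> \<A> \<Longrightarrow> \<exists>\<gamma><\<xi>. closedin (\<tau> \<gamma>) (F B)"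
      "\<And>B. B \<in> \<A> \<Longrightarrow> tame_small \<tau> \<beta> (B - F B)" "\<And>B. B \<in> \<A> \<Longrightarrow> tame_small \<tau> \<beta> (F B - B)"
      by simp_all
    \<comment> \<open>The approximant of \<open>A\<close> will be \<open>X - W\<close>. Interiors
      replace the sets \<open>F B\<close> because a countable union of closed sets need not have a
      closed complement.\<close>
    define W where "W = (\<Union>B\<in>\<A>. \<tau> \<xi> interior_of F B)"
    have boundary_small: "tame_small \<tau> \<beta> (F B - \<tau> \<xi> interior_of F B)" if B: "B \<in> \<A>" for B
    proof (rule tame_small_tame)
      obtain \<gamma> where \<gamma>: "\<gamma> < \<xi>" "closedin (\<tau> \<gamma>) (F B)"
        using F(1)[OF B] by blast
      have \<gamma>\<beta>: "\<gamma> < \<beta>"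
        using \<gamma>(1) less.prems(1) by simp
      have "closedin (\<tau> \<xi>) (F B)"
        by (rule filtration_from_closedin_mono[OF filt down[OF \<gamma>\<beta>] \<xi>R less_imp_le[OF \<gamma>(1)] \<gamma>(2)])
      then have "closedin (\<tau> \<xi>) (F B - \<tau> \<xi> interior_of F B)"
        by (simp add: closedin_diff)
      then show "F B - \<tau> \<xi> interior_of F B \<in> tame \<tau> \<beta>"
        using less.prems(1) by (rule tame.closed[rotated])
      \<comment> \<open>Since \<open>\<gamma>\<close> is below both \<open>\<xi>\<close> and
        \<open>\<beta>\<close>, both interiors equal the one in the supremum topology.\<close>
      have "\<tau> \<beta> interior_of F B = \<tau> \<xi> interior_of F B"
        using filtration_from_interior_of[OF filt \<gamma>(1) \<xi>R \<gamma>(2)]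
          filtration_from_interior_of[OF filt \<gamma>\<beta> \<beta> \<gamma>(2)] by simp
      then show "\<tau> \<beta> interior_of (F B - \<tau> \<xi> interior_of F B) = {}"
        using interior_of_mono[of "F B - \<tau> \<xi> interior_of F B" "F B" "\<tau> \<beta>"]
          interior_of_subset[of "\<tau> \<beta>" "F B - \<tau> \<xi> interior_of F B"] by blast
    qed
    have "tame_small \<tau> \<beta> (\<Union>B\<in>\<A>. F B - B)"
      using \<A>(1) F(3) by (rule tame_small_UN)
    \<comment> \<open>A point of \<open>A\<close> in \<open>W\<close> lies in some
      \<open>F B\<close> but in no member of \<open>\<A>\<close>.\<close>
    moreover have "A - (X - W) \<subseteq> (\<Union>B\<in>\<A>. F B - B)"
      using interior_of_subset[of "\<tau> \<xi>"] unfolding W_def A ts by fastforce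
    ultimately have small1: "tame_small \<tau> \<beta> (A - (X - W))"
      by (rule tame_small_subset)
    have "tame_small \<tau> \<beta> (\<Union>B\<in>\<A>. (B - F B) \<union> (F B - \<tau> \<xi> interior_of F B))"
      using \<A>(1) F(2) boundary_small by (intro tame_small_UN tame_small_Un)
    \<comment> \<open>A point outside \<open>A\<close> lies in some \<open>B\<close>; being outside
      \<open>W\<close>, it misses \<open>F B\<close> or lies in \<open>F B\<close> off its
      interior.\<close>
    moreover have "(X - W) - A \<subseteq> (\<Union>B\<in>\<A>. (B - F B) \<union> (F B - \<tau> \<xi> interior_of F B))"
      unfolding W_def A ts by blast
    ultimately have small2: "tame_small \<tau> \<beta> ((X - W) - A)"
      by (rule tame_small_subset)
    have "openin (\<tau> \<xi>) W"
      unfolding W_def by (rule openin_Union) auto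
    then have "closedin (\<tau> \<xi>) (X - W)"
      using closedin_diff[OF closedin_topspace] ts by metis
    then show ?thesis
      using small1 small2 by blast
  qed
qed

text \<open>This is what the operation \<open>\<alpha> \<oplus> 1\<close> is for: if
  \<open>\<alpha>\<close> is a successor, \<open>\<alpha>\<close> itself is an index above
  \<open>\<xi>\<close>; otherwise the indices below \<open>\<alpha>\<close> have no maximum.\<close>

lemma below_oplus1_no_max:
  assumes "\<xi> < \<alpha>"
  obtains \<beta> where "\<xi> < \<beta>" "\<beta> \<in> below_oplus1 \<alpha>"
proof (cases "is_successor \<alpha>")
  case True
  then show thesis
    using that assms unfolding below_oplus1_def by simp
next
  case False
  then obtain \<gamma> where "\<gamma> < \<alpha>" "\<xi> < \<gamma>"
    using assms unfolding is_successor_def by (meson not_le)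
  then show thesis
    using that False unfolding below_oplus1_def by simp
qed

lemma below_oplus1_downward: "\<xi> < \<beta> \<Longrightarrow> \<beta> \<in> below_oplus1 \<alpha> \<Longrightarrow> \<xi> \<in> below_oplus1 \<alpha>"
  unfolding below_oplus1_def by (auto split: if_splits)

lemma solid_same_closure_meet:
  assumes filt: "filtration_from X \<sigma> R \<tau>"
    and \<beta>: "\<beta> \<in> R" and down: "\<And>\<xi>. \<xi> < \<beta> \<Longrightarrow> \<xi> \<in> R"
    and \<xi>: "\<xi> < \<beta>" and C: "C \<in> Pi0 \<sigma> \<xi>"
    and sub: "C \<subseteq> X" "D \<subseteq> X"
    and solid: "solid_at \<tau> \<beta> C" "solid_at \<tau> \<beta> D"
    and cl: "D \<subseteq> \<tau> \<xi> closure_of C" and "D \<noteq> {}"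
  shows "C \<inter> D \<noteq> {}"
proof
  assume disj: "C \<inter> D = {}"
  obtain F where F: "closedin (\<tau> \<xi>) F" "tame_small \<tau> \<beta> (C - F)" "tame_small \<tau> \<beta> (F - C)"
    using Pi0_closed_mod_small[OF filt \<beta> down \<xi> C] by blast
  have ts: "topspace (\<tau> \<xi>) = X" "topspace (\<tau> \<beta>) = X"
    using filtration_from_topspace[OF filt] \<beta> down[OF \<xi>] by simp_all
  have "openin (\<tau> \<beta>) (X - F)"
    using filtration_from_closedin_mono[OF filt down[OF \<xi>] \<beta> less_imp_le[OF \<xi>] F(1)] ts
    by (simp add: closedin_def)
  \<comment> \<open>The complement of \<open>F\<close> is open already at level
    \<open>\<xi>\<close>, hence at level \<open>\<beta>\<close>, where solidity is tested.\<close>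
  moreover have "C - F = (X - F) \<inter> C"
    using sub by blast
  ultimately have "openin (subtopology (\<tau> \<beta>) C) (C - F)"
    unfolding openin_subtopology by blast
  then have "C \<subseteq> F"
    using solid_at_small_open_empty[OF solid(1) _ F(2)] by blast
  then have "D \<subseteq> F"
    using cl closure_of_minimal[OF _ F(1)] by (meson order_trans)
  then have "tame_small \<tau> \<beta> D"
    using disj by (intro tame_small_subset[OF F(3)]) blast
  moreover have "openin (subtopology (\<tau> \<beta>) D) D"
    using sub(2) ts(2) by (simp add: openin_subtopology_refl)
  ultimately show False
    using solid_at_small_open_empty[OF solid(2)] \<open>D \<noteq> {}\<close> by blast
qed

text \<open>The factor \<open>X \<times> X\<close> gives the intersection its meaning when no index
  lies below \<open>\<alpha>\<close>: an empty intersection would otherwise be the whole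
  type.\<close>

theorem theorem5p1:
  fixes X :: "'a set"
    and \<sigma> :: "'a topology"
    and \<alpha> :: "'i::wellorder"
    and \<tau> :: "'i \<Rightarrow> 'a topology"
    and E :: "('a \<times> 'a) set"
  assumes "le_omega1 \<alpha>"
    and "filtration_from X \<sigma> (below_oplus1 \<alpha>) \<tau>"
    and "\<And>\<xi>. \<xi> < \<alpha> \<Longrightarrow> completely_metrizable_space (\<tau> \<xi>)"
    and "equiv X E"
    and "\<And>C. C \<in> X // E \<Longrightarrow> solid (below_oplus1 \<alpha>) \<tau> C"
    and "\<And>C. C \<in> X // E \<Longrightarrow> C \<in> (\<Union>\<xi>\<in>{..<\<alpha>}. Pi0 \<sigma> \<xi>)"
  shows "E = (X \<times> X) \<inter> (\<Inter>\<xi>\<in>{..<\<alpha>}. closure_equiv X \<tau> E \<xi>)"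
proof (intro subset_antisym subrelI)
  fix x y assume xy: "(x, y) \<in> E"
  then have "x \<in> X" "y \<in> X" "E `` {x} = E `` {y}"
    using assms(4) by (simp_all add: equiv_class_eq_iff)
  then show "(x, y) \<in> (X \<times> X) \<inter> (\<Inter>\<xi>\<in>{..<\<alpha>}. closure_equiv X \<tau> E \<xi>)"
    by (simp add: closure_equiv_def)
next
  fix x y assume xy: "(x, y) \<in> (X \<times> X) \<inter> (\<Inter>\<xi>\<in>{..<\<alpha>}. closure_equiv X \<tau> E \<xi>)"
  define C where "C = E `` {x}"
  define D where "D = E `` {y}"
  have CD: "C \<in> X // E" "D \<in> X // E" and y: "y \<in> D"
    using xy equiv_class_self[OF assms(4)] unfolding C_def D_def by (auto intro: quotientI)
  have sub: "C \<subseteq> X" "D \<subseteq> X"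
    using in_quotient_imp_subset[OF assms(4)] CD by auto
  obtain \<xi> where \<xi>: "\<xi> < \<alpha>" "C \<in> Pi0 \<sigma> \<xi>"
    using assms(6)[OF CD(1)] by blast
  \<comment> \<open>Solidity is used strictly above \<open>\<xi>\<close>, so that
    \<open>\<tau> \<xi>\<close>-closed sets are \<open>\<beta>\<close>-tame.\<close>
  obtain \<beta> where \<beta>: "\<xi> < \<beta>" "\<beta> \<in> below_oplus1 \<alpha>"
    using below_oplus1_no_max[OF \<xi>(1)] .
  have "topspace (\<tau> \<xi>) = X"
    by (rule filtration_from_topspace[OF assms(2) below_oplus1_downward[OF \<beta>]])
  moreover have "\<tau> \<xi> closure_of C = \<tau> \<xi> closure_of D"
    using xy \<xi>(1) by (simp add: closure_equiv_def C_def D_def)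
  ultimately have "D \<subseteq> \<tau> \<xi> closure_of C"
    using sub(2) by (simp add: closure_of_subset)
  then have "C \<inter> D \<noteq> {}"
    using solid_same_closure_meet[OF assms(2) \<beta>(2) below_oplus1_downward[OF _ \<beta>(2)] \<beta>(1) \<xi>(2) sub]
      assms(5)[OF CD(1)] assms(5)[OF CD(2)] \<beta>(2) y unfolding solid_def by blast
  then have "C = D"
    using quotient_disj[OF assms(4) CD] by blast
  then show "(x, y) \<in> E"
    using y unfolding C_def by blast
qed

end
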